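(* Let $p,q\ge 0$ be integers with $n=p+q\ge 1$. a) The subspaces $$\widehat{\mathbf 0},\qquad \widehat{\mathbf 0}\oplus\widehat{\mathbf n},\qquad \widehat{\mathbf 0}\oplus\widehat{\mathbf 2}\oplus\ldots\oplus\widehat{\mathbf k}=\overline{\mathbf{02}}$$ (with $k$ the even number among $n,n-1$) are subalgebras of the real Clifford algebra $\mathcal{C}\!\ell^{\mathbb R}(p,q)$. b) The subspaces (with $k$ the even number among $n,n-1$) $$\widehat{\mathbf 0},\qquad \widehat{\mathbf 0}\oplus\widehat{\mathbf n},\qquad \widehat{\mathbf 0}\oplus\widehat{\mathbf 2}\oplus\ldots\oplus\widehat{\mathbf k}=\overline{\mathbf{02}},$$ $$\widehat{\mathbf 0}\oplus i\widehat{\mathbf 0},\qquad \widehat{\mathbf 0}\oplus\widehat{\mathbf n}\oplus i\widehat{\mathbf 0}\oplus i\widehat{\mathbf n},$$ $$\widehat{\mathbf 0}\oplus i\widehat{\mathbf 0}\oplus\widehat{\mathbf 2}\oplus i\widehat{\mathbf 2}\oplus\ldots\oplus\widehat{\mathbf k}\oplus i\widehat{\mathbf k}=\overline{\mathbf{02}}\oplus i\,\overline{\mathbf{02}},$$ $$\widehat{\mathbf 0}\oplus i\widehat{\mathbf 1}\oplus\widehat{\mathbf 2}\oplus i\widehat{\mathbf 3}\oplus\ldots\oplus i^n(-1)^{n(n-1)/2}\,\widehat{\mathbf n}=\overline{\mathbf{02}}\oplus i\,\overline{\mathbf{13}},$$ $$\widehat{\mathbf 0}\oplus\widehat{\mathbf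 1}\oplus\widehat{\mathbf 2}\oplus\ldots\oplus\widehat{\mathbf n}=\overline{\mathbf{0123}}$$ are subalgebras (closed under the Clifford product) of the complex Clifford algebra $\mathcal{C}\!\ell^{\mathbb C}(p,q)$.
   Context: $\mathcal{C}\!\ell^{\mathbb F}(p,q)$ ($\mathbb F=\mathbb R$ or $\mathbb C$) is the Clifford algebra over $\mathbb F$ with identity $e$ and generators $e^1,\dots,e^n$, $n=p+q$, satisfying $e^ae^b+e^be^a=2\eta^{ab}e$, where $\eta$ is diagonal with $p$ entries $+1$ followed by $q$ entries $-1$. The $2^n$ elements $e$ and $e^{a_1\ldots a_k}=e^{a_1}\cdots e^{a_k}$ ($a_1<\dots<a_k$, $1\le k\le n$) form an $\mathbb F$-basis. We regard $\mathcal{C}\!\ell^{\mathbb R}(p,q)\subset\mathcal{C}\!\ell^{\mathbb C}(p,q)=\mathcal{C}\!\ell^{\mathbb R}(p,q)\oplus i\,\mathcal{C}\!\ell^{\mathbb R}(p,q)$. $\widehat{\mathbf k}=\mathcal{C}\!\ell^{\mathbb R}_k(p,q)$ is the real span of the basis elements with $k$ indices (rank $k$; $\widehat{\mathbf 0}=\mathbb R e$). For $k\in\{0,1,2,3\}$, $\overline{\mathbf k}=\bigoplus_{j\equiv k\,(\mathrm{mod}\,4),\,0\le j\le n}\widehat{\mathbf j}$; $\overline{\mathbf{kl}}=\overline{\mathbf k}\oplus\overline{\mathbf l}$, $\overline{\mathbf{0123}}=\mathcal{C}\!\ell^{\mathbb R}(p,q)$. For a nonzero scalar $c$, $c\,\widehat{\mathbf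 k}=\{cU:U\in\widehat{\mathbf k}\}$; a sign in front does not change the subspace, so $i^n(-1)^{n(n-1)/2}\,\widehat{\mathbf n}$ equals $\widehat{\mathbf n}$ for even $n$ and $i\widehat{\mathbf n}$ for odd $n$. Subspaces and subalgebras of $\mathcal{C}\!\ell^{\mathbb C}(p,q)$ are understood over $\mathbb R$. *)

theory Defs
  imports Complex_Main "HOL-Library.Set_Algebras"
begin

text \<open>The product of the generators with index set \<open>A = {a\<^sub>1 < \<dots> < a\<^sub>k}\<close>, in increasing order; the empty set gives the identity.\<close>

definition blade :: "(nat \<Rightarrow> 'a::monoid_mult) \<Rightarrow> nat set \<Rightarrow> 'a" where
  "blade g A = prod_list (map g (sorted_list_of_set A))"

definition eta :: "nat \<Rightarrow> nat \<Rightarrow> nat \<Rightarrow> 'f::ring_1" where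
  "eta p a b = (if a = b then if a \<le> p then 1 else - 1 else 0)"

text \<open>The locale says that the whole ring type, with scalar multiplication \<open>scale\<close> by the field and
  generators \<open>g 1, \<dots>, g (p + q)\<close>, is the Clifford algebra of signature \<open>(p, q)\<close>. Values of \<open>g\<close> at
  other indices are irrelevant. Together with the relations, the basis property determines the
  algebra up to isomorphism. Injectivity makes the \<open>2 ^ (p + q)\<close> basis elements pairwise distinct.\<close>

locale clifford_algebra = vector_space scale
  for scale :: "'f::field \<Rightarrow> 'a::ring_1 \<Rightarrow> 'a" +
  fixes g :: "nat \<Rightarrow> 'a" and p q :: nat
  assumes scale_mult_left: "scale c x * y = scale c (x * y)"
    and scale_mult_right: "x * scale c y = scale c (x * y)"
    and generator_relations: "\<And>a b. a \<in> {1..p + q} \<Longrightarrow> b \<in> {1..p + q} \<Longrightarrow>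
      g a * g b + g b * g a = scale (2 * eta p a b) 1"
    and blade_inj: "inj_on (blade g) (Pow {1..p + q})"
    and blade_independent: "\<not> dependent (blade g ` Pow {1..p + q})"
    and blade_span: "span (blade g ` Pow {1..p + q}) = UNIV"

text \<open>Subspaces and subalgebras are always taken over the reals, so for a complex algebra the
  argument \<open>rs\<close> below is the complex scalar multiplication restricted to real scalars.\<close>

definition restrict_real :: "(complex \<Rightarrow> 'a \<Rightarrow> 'a) \<Rightarrow> real \<Rightarrow> 'a \<Rightarrow> 'a" where
  "restrict_real s r x = s (complex_of_real r) x"

definition subalgebra :: "(real \<Rightarrow> 'a::ring_1 \<Rightarrow> 'a) \<Rightarrow> 'a set \<Rightarrow> bool" where
  "subalgebra rs S \<longleftrightarrow> module.subspace rs S \<and> (\<forall>x\<in>S. \<forall>y\<in>S. x * y \<in> S)"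

definition rank_space :: "(real \<Rightarrow> 'a::ring_1 \<Rightarrow> 'a) \<Rightarrow> (nat \<Rightarrow> 'a) \<Rightarrow> nat \<Rightarrow> nat \<Rightarrow> 'a set" where
  "rank_space rs g n k = module.span rs (blade g ` {A. A \<subseteq> {1..n} \<and> card A = k})"

text \<open>\<open>bar_space rs g n [k, l, \<dots>]\<close> is the sum of all rank spaces whose rank is congruent to one of
  \<open>k, l, \<dots>\<close> modulo 4. The sum of a list of sets is the Minkowski sum, which is \<open>{0}\<close> for the
  empty list.\<close>

definition bar_space :: "(real \<Rightarrow> 'a::ring_1 \<Rightarrow> 'a) \<Rightarrow> (nat \<Rightarrow> 'a) \<Rightarrow> nat \<Rightarrow> nat list \<Rightarrow> 'a set" where
  "bar_space rs g n ks =
    (\<Sum>k\<leftarrow>ks. \<Sum>j\<leftarrow>filter (\<lambda>j. j mod 4 = k) [0..<Suc n]. rank_space rs g n j)"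

text \<open>\<open>W\<close> is the internal direct sum of the subspaces in the list \<open>Vs\<close>; for subspaces, uniqueness of
  the decomposition of \<open>0\<close> is uniqueness of all decompositions.\<close>

definition is_direct_sum :: "'a::comm_monoid_add set \<Rightarrow> 'a set list \<Rightarrow> bool" where
  "is_direct_sum W Vs \<longleftrightarrow> W = sum_list Vs \<and>
    (\<forall>us. list_all2 (\<in>) us Vs \<and> sum_list us = 0 \<longrightarrow> (\<forall>u\<in>set us. u = 0))"

end

theory Submission imports Defs begin

text \<open>Up to sign, the product of the basis elements with index sets \<open>A\<close> and \<open>B\<close> is the basis element
  of the symmetric difference of \<open>A\<close> and \<open>B\<close>. Over the reals, the elements \<open>e\<^sup>A\<close> and \<open>i e\<^sup>A\<close> are linearly
  independent, and every subspace in question is spanned by those whose rank and phase (\<open>1\<close> or \<open>i\<close>)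
  lie in some set. Sums of such spaces for disjoint sets are direct, and closure under
  multiplication becomes closure of the set under symmetric difference of indices (with addition
  of phases modulo 2).\<close>

section \<open>Sums of sets, parity and symmetric differences\<close>

lemma sum_list_mem_sum_list:
  fixes us :: "'a::comm_monoid_add list"
  shows "list_all2 (\<in>) us Vs \<Longrightarrow> sum_list us \<in> sum_list Vs"
  by (induction rule: list_all2_induct) (auto intro: set_plus_intro)

lemma mod_4_parity:
  "j mod 4 = 0 \<or> j mod 4 = 2 \<longleftrightarrow> even (j::nat)" "j mod 4 = Suc 0 \<or> j mod 4 = 3 \<longleftrightarrow> odd (j::nat)"
  by presburger+

text \<open>The common elements are counted in both \<open>card A\<close> and \<open>card B\<close>
  but not in the symmetric difference, so \<open>card A + card B\<close> exceeds its size by twice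
  \<open>card (A \<inter> B)\<close>. This makes the parity of the rank additive under products of
  blades.\<close>

lemma even_card_sym_diff:
  assumes "finite A" "finite B"
  shows "even (card (sym_diff A B)) \<longleftrightarrow> (even (card A) \<longleftrightarrow> even (card B))"
proof -
  have "card A = card (A \<inter> B) + card (A - B)" "card B = card (A \<inter> B) + card (B - A)"
    using card_Int_Diff[of A B] card_Int_Diff[of B A] assms by (auto simp: Int_commute)
  moreover have "card (sym_diff A B) = card (A - B) + card (B - A)"
    using assms by (intro card_Un_disjoint) auto
  ultimately show ?thesis by auto
qed

text \<open>Only \<open>j = n\<close> could make a difference, and then \<open>n\<close> is even,
  \<open>n - 1\<close> is odd, and \<open>k\<close> must be \<open>n\<close>. So a list of even
  ranks ending at \<open>k\<close> misses no even rank of the algebra.\<close>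

lemma even_le_even_bound:
  assumes "n \<ge> 1" "even k" "k \<in> {n, n - 1}" "even j"
  shows "j < Suc k \<longleftrightarrow> j \<le> (n::nat)"
  using assms by (cases "j = n") auto

section \<open>Products of blades\<close>

lemma blade_empty [simp]: "blade g {} = 1"
  by (simp add: blade_def)

text \<open>A new smallest index goes to the front of the sorted list. The inductions below
  therefore build index sets by inserting minima.\<close>

lemma blade_insert_min:
  assumes "finite A" "\<And>x. x \<in> A \<Longrightarrow> b < x"
  shows "blade g (insert b A) = g b * blade g A"
proof -
  have "b \<notin> A" using assms(2) by blast
  then have "sorted_list_of_set (insert b A) = b # sorted_list_of_set A"
    using assms by (simp add: insort_is_Cons less_imp_le)
  then show ?thesis by (simp add: blade_def)
qed

text \<open>The generator \<open>g a\<close> moves right through the increasing product, changing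
  sign at each smaller index, until it finds its place or meets its own copy and cancels up to
  sign.\<close>

lemma generator_times_blade:
  fixes g :: "nat \<Rightarrow> 'a::ring_1"
  assumes anti: "\<And>a b. a \<in> I \<Longrightarrow> b \<in> I \<Longrightarrow> a \<noteq> b \<Longrightarrow> g a * g b = - (g b * g a)"
    and sq: "\<And>a. a \<in> I \<Longrightarrow> g a * g a \<in> {1, - 1}"
    and "finite B" "B \<subseteq> I" "a \<in> I"
  shows "g a * blade g B \<in> {blade g (sym_diff {a} B), - blade g (sym_diff {a} B)}"
  using \<open>finite B\<close> \<open>B \<subseteq> I\<close>
proof (induction B rule: finite_linorder_min_induct)
  case empty
  show ?case using blade_insert_min[of "{}" a g] by simp
next
  case (insert b B)
  have b: "b \<in> I" and IH: "g a * blade g B \<in> {blade g (sym_diff {a} B), - blade g (sym_diff {a} B)}"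
    using insert by auto
  have bl: "blade g (insert b B) = g b * blade g B"
    using insert by (intro blade_insert_min) auto
  consider "a < b" | "a = b" | "b < a" by linarith
  then show ?case
  proof cases
    case 1
    then have "sym_diff {a} (insert b B) = insert a (insert b B)" using insert by fastforce
    moreover have "blade g (insert a (insert b B)) = g a * blade g (insert b B)"
      using 1 insert by (intro blade_insert_min) auto
    ultimately show ?thesis by simp
  next
    case 2
    then have "sym_diff {a} (insert b B) = B" using insert by fastforce
    moreover have "g a * blade g (insert b B) = (g a * g a) * blade g B"
      using bl 2 by (simp add: mult.assoc)
    moreover from sq[OF \<open>a \<in> I\<close>] have "g a * g a = 1 \<or> g a * g a = - 1" by simp
    ultimately show ?thesis by (elim disjE) simp_all
  next
    case 3
    then have "sym_diff {a} (insert b B) = insert b (sym_diff {a} B)" by auto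
    moreover have "blade g (insert b (sym_diff {a} B)) = g b * blade g (sym_diff {a} B)"
      using 3 insert by (intro blade_insert_min) auto
    \<comment> \<open>One transposition moves \<open>g a\<close> past the smallest factor
      \<open>g b\<close>; the induction hypothesis handles the rest.\<close>
    moreover have "g a * blade g (insert b B) = - (g b * (g a * blade g B))"
    proof -
      have "g a * blade g (insert b B) = (g a * g b) * blade g B" by (simp only: bl mult.assoc)
      also have "g a * g b = - (g b * g a)" using anti[OF \<open>a \<in> I\<close> b] 3 by simp
      finally show ?thesis by (simp add: mult.assoc)
    qed
    moreover from IH have "g a * blade g B = blade g (sym_diff {a} B)
        \<or> g a * blade g B = - blade g (sym_diff {a} B)" by simp
    ultimately show ?thesis by (elim disjE) simp_all
  qed
qed

text \<open>The smallest generator is split off \<open>A\<close>; the remaining product is a signed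
  blade by induction, and one generator acts on it by the previous lemma. Associativity of the
  symmetric difference identifies the resulting index set.\<close>

lemma blade_times_blade:
  fixes g :: "nat \<Rightarrow> 'a::ring_1"
  assumes anti: "\<And>a b. a \<in> I \<Longrightarrow> b \<in> I \<Longrightarrow> a \<noteq> b \<Longrightarrow> g a * g b = - (g b * g a)"
    and sq: "\<And>a. a \<in> I \<Longrightarrow> g a * g a \<in> {1, - 1}"
    and "finite A" "A \<subseteq> I" "finite B" "B \<subseteq> I"
  shows "blade g A * blade g B \<in> {blade g (sym_diff A B), - blade g (sym_diff A B)}"
  using \<open>finite A\<close> \<open>A \<subseteq> I\<close>
proof (induction A rule: finite_linorder_min_induct)
  case empty
  show ?case by simp
next
  case (insert a A)
  have a: "a \<in> I" and IH: "blade g A * blade g B \<in> {blade g (sym_diff A B), - blade g (sym_diff A B)}"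
    using insert by auto
  have "blade g (insert a A) = g a * blade g A"
    using insert by (intro blade_insert_min) auto
  then have "blade g (insert a A) * blade g B = g a * (blade g A * blade g B)"
    by (simp add: mult.assoc)
  moreover have "sym_diff {a} (sym_diff A B) = sym_diff (insert a A) B" using insert by auto
  moreover have "g a * blade g (sym_diff A B)
      \<in> {blade g (sym_diff {a} (sym_diff A B)), - blade g (sym_diff {a} (sym_diff A B))}"
    using insert \<open>finite B\<close> \<open>B \<subseteq> I\<close> a by (intro generator_times_blade[OF anti sq]) auto
  ultimately show ?case using IH by auto
qed

section \<open>Multiplication and independence of blades in a Clifford algebra\<close>

context clifford_algebra
begin

text \<open>For \<open>a = b\<close> the defining relation determines only twice the square of a
  generator, hence the assumption that 2 is invertible in the field.\<close>

lemma blade_mult: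
  assumes "(2::'f) \<noteq> 0" "A \<subseteq> {1..p + q}" "B \<subseteq> {1..p + q}"
  shows "blade g A * blade g B \<in> {blade g (sym_diff A B), - blade g (sym_diff A B)}"
proof (rule blade_times_blade[where I = "{1..p + q}"])
  show "g a * g b = - (g b * g a)" if "a \<in> {1..p + q}" "b \<in> {1..p + q}" "a \<noteq> b" for a b
    using generator_relations[OF that(1,2)] that(3) by (simp add: eta_def eq_neg_iff_add_eq_0)
  show "g a * g a \<in> {1, - 1}" if "a \<in> {1..p + q}" for a
  proof -
    have "scale 2 (g a * g a) = scale 1 (g a * g a) + scale 1 (g a * g a)"
      by (simp only: scale_left_distrib[symmetric] one_add_one)
    also have "\<dots> = scale 2 (scale (eta p a a) 1)"
      using generator_relations[OF that that] by simp
    finally have "g a * g a = scale (eta p a a) 1"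
      using assms(1) scale_left_imp_eq by blast
    then show ?thesis by (auto simp: eta_def)
  qed
qed (use assms in \<open>auto intro: finite_subset\<close>)

text \<open>Independence is assumed for a set of vectors. Since \<open>blade g\<close> is injective
  on the index sets, coefficients can be carried over to the vectors, which gives independence of
  the indexed family.\<close>

lemma blade_sum_zero:
  assumes "(\<Sum>A\<in>Pow {1..p + q}. scale (c A) (blade g A)) = 0" "A \<subseteq> {1..p + q}"
  shows "c A = 0"
proof -
  let ?P = "Pow {1..p + q}"
  define d where "d v = c (the_inv_into ?P (blade g) v)" for v
  have d: "d (blade g A) = c A" if "A \<in> ?P" for A
    using that blade_inj by (simp add: d_def the_inv_into_f_f)
  have "(\<Sum>v\<in>blade g ` ?P. scale (d v) v) = (\<Sum>A\<in>?P. scale (c A) (blade g A))"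
    by (subst sum.reindex[OF blade_inj]) (auto intro!: sum.cong simp: d simp del: Pow_iff)
  then have "d (blade g A) = 0"
    using assms blade_independent by (intro independentD[where t = "blade g ` ?P"]) auto
  then show ?thesis using d assms(2) by simp
qed

end

section \<open>Spaces spanned by blades of prescribed rank and phase\<close>

text \<open>In \<open>u (A, b)\<close>, the flag \<open>b\<close> says whether the blade of \<open>A\<close> is multiplied by the imaginary unit.
  For the real algebra the set \<open>Ph\<close> of admissible flags is \<open>{False}\<close>.\<close>

locale phased_blades = vector_space rs
  for rs :: "real \<Rightarrow> 'a::ring_1 \<Rightarrow> 'a" +
  fixes g :: "nat \<Rightarrow> 'a" and n :: nat and Ph :: "bool set" and u :: "nat set \<times> bool \<Rightarrow> 'a"
  assumes rs_mult_left: "\<And>c x y. rs c x * y = rs c (x * y)"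
    and rs_mult_right: "\<And>c x y. x * rs c y = rs c (x * y)"
    and u_real: "u (A, False) = blade g A"
    and False_phase: "False \<in> Ph"
    and phase_closed: "b \<in> Ph \<Longrightarrow> b' \<in> Ph \<Longrightarrow> (b \<noteq> b') \<in> Ph"
    and u_mult: "A \<subseteq> {1..n} \<Longrightarrow> B \<subseteq> {1..n} \<Longrightarrow> b \<in> Ph \<Longrightarrow> b' \<in> Ph \<Longrightarrow>
      u (A, b) * u (B, b') \<in> {u (sym_diff A B, b \<noteq> b'), - u (sym_diff A B, b \<noteq> b')}"
    and u_independent: "\<And>c x. (\<Sum>x\<in>Pow {1..n} \<times> Ph. rs (c x) (u x)) = 0 \<Longrightarrow>
      x \<in> Pow {1..n} \<times> Ph \<Longrightarrow> c x = 0"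
begin

text \<open>Pairs in \<open>L\<close> with an impossible rank or phase select nothing, so
  \<open>L\<close> can be as simple a set as "all even ranks", without reference to \<open>n\<close>
  or \<open>Ph\<close>.\<close>

definition graded :: "(nat \<times> bool) set \<Rightarrow> (nat set \<times> bool) set" where
  "graded L = {x \<in> Pow {1..n} \<times> Ph. (card (fst x), snd x) \<in> L}"

definition grade_space :: "(nat \<times> bool) set \<Rightarrow> 'a set" where
  "grade_space L = span (u ` graded L)"

lemma finite_graded: "finite (graded L)"
  by (rule finite_subset[of _ "Pow {1..n} \<times> Ph"]) (auto simp: graded_def)

lemma grade_space_cong:
  assumes "\<And>j b. j \<le> n \<Longrightarrow> (j, b) \<in> L \<longleftrightarrow> (j, b) \<in> M"
  shows "grade_space L = grade_space M"
proof -
  have "card A \<le> n" if "A \<subseteq> {1..n}" for A using card_mono[OF _ that] by simp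
  then have "graded L = graded M" using assms by (auto simp: graded_def)
  then show ?thesis by (simp add: grade_space_def)
qed

lemma rank_space_eq: "rank_space rs g n k = grade_space {(k, False)}"
proof -
  have "graded {(k, False)} = (\<lambda>A. (A, False)) ` {A. A \<subseteq> {1..n} \<and> card A = k}"
    using False_phase by (auto simp: graded_def)
  then show ?thesis by (simp add: rank_space_def grade_space_def image_image u_real)
qed

lemma grade_space_empty: "grade_space {} = {0}"
  by (simp add: grade_space_def graded_def)

lemma grade_space_Un: "grade_space (L \<union> M) = grade_space L + grade_space M"
proof -
  have "graded (L \<union> M) = graded L \<union> graded M" by (auto simp: graded_def)
  then show ?thesis by (auto simp: grade_space_def image_Un span_Un set_plus_def)
qed

lemma sum_list_grade_space: "sum_list (map grade_space Ls) = grade_space (\<Union> (set Ls))"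
  by (induction Ls) (simp_all add: grade_space_empty grade_space_Un)

lemma bar_space_eq: "bar_space rs g n ks = grade_space ({j. j mod 4 \<in> set ks} \<times> {False})"
proof -
  have "(\<Sum>j\<leftarrow>filter (\<lambda>j. j mod 4 = k) [0..<Suc n]. rank_space rs g n j)
      = grade_space ({j. j mod 4 = k} \<times> {False})" for k
  proof -
    have "(\<Sum>j\<leftarrow>filter (\<lambda>j. j mod 4 = k) [0..<Suc n]. rank_space rs g n j)
      = sum_list (map grade_space (map (\<lambda>j. {(j, False)}) (filter (\<lambda>j. j mod 4 = k) [0..<Suc n])))"
      by (simp only: map_map o_def rank_space_eq)
    also have "\<dots> = grade_space ({j. j mod 4 = k} \<times> {False})"
      unfolding sum_list_grade_space by (rule grade_space_cong) (auto simp: less_Suc_eq_le simp del: upt_Suc)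
    finally show ?thesis .
  qed
  then have "bar_space rs g n ks
      = sum_list (map grade_space (map (\<lambda>k. {j. j mod 4 = k} \<times> {False}) ks))"
    by (simp only: map_map o_def bar_space_def)
  also have "\<dots> = grade_space ({j. j mod 4 \<in> set ks} \<times> {False})"
    unfolding sum_list_grade_space by (rule grade_space_cong) auto
  finally show ?thesis .
qed

section \<open>Direct sums\<close>

lemma span_u_sum:
  assumes "finite J" "x \<in> span (u ` J)"
  shows "\<exists>c. x = (\<Sum>j\<in>J. rs (c j) (u j))"
  using assms(2)
proof (induction rule: span_induct_alt)
  case base
  show ?case by (intro exI[of _ "\<lambda>_. 0"]) simp
next
  case (step r v y)
  then obtain c j where j: "j \<in> J" "v = u j" and c: "y = (\<Sum>j\<in>J. rs (c j) (u j))" by auto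
  have "rs r v + y = (\<Sum>i\<in>J. rs ((c(j := r + c j)) i) (u i))"
    using j assms(1) c by (simp add: sum.remove[of J j] scale_left_distrib add.assoc)
  then show ?case by blast
qed

text \<open>Both expansions of \<open>x\<close> are padded with zero coefficients to the full index
  set and subtracted; independence then makes every coefficient of the difference vanish.\<close>

lemma grade_space_disjnt:
  assumes "disjnt L M" "x \<in> grade_space L" "x \<in> grade_space M"
  shows "x = 0"
proof -
  obtain c d where c: "x = (\<Sum>j\<in>graded L. rs (c j) (u j))" and d: "x = (\<Sum>j\<in>graded M. rs (d j) (u j))"
    using span_u_sum[OF finite_graded] assms(2,3) unfolding grade_space_def by metis
  let ?I = "Pow {1..n} \<times> Ph"
  have "(\<Sum>j\<in>?I. rs (if j \<in> graded N then e j else 0) (u j)) = (\<Sum>j\<in>graded N. rs (e j) (u j))" for N e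
    by (rule sum.mono_neutral_cong_right) (auto simp: graded_def)
  then have "(\<Sum>j\<in>?I. rs ((if j \<in> graded L then c j else 0) - (if j \<in> graded M then d j else 0)) (u j)) = 0"
    using c d by (simp add: scale_left_diff_distrib sum_subtractf)
  note * = u_independent[OF this]
  \<comment> \<open>At an index of \<open>graded L\<close> the padded coefficient from
    \<open>M\<close> is 0, so the vanishing difference is \<open>c j\<close> itself.\<close>
  have "c j = 0" if "j \<in> graded L" for j
  proof -
    have "j \<in> ?I" "j \<notin> graded M" using that assms(1) by (auto simp: graded_def disjnt_iff)
    then show ?thesis using *[of j] that by simp
  qed
  then show ?thesis using c by simp
qed

text \<open>If the summands add up to 0, the first one is minus the sum of the others. It then lies
  in two spaces with disjoint labels and must vanish; induction on the list treats the rest.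
  \<open>L\<close> is compared with the union only at ranks up to \<open>n\<close>, so it may be
  infinite.\<close>

lemma is_direct_sum_grade_space:
  assumes "sorted_wrt disjnt Ls" "\<And>j b. j \<le> n \<Longrightarrow> (j, b) \<in> L \<longleftrightarrow> (j, b) \<in> \<Union> (set Ls)"
  shows "is_direct_sum (grade_space L) (map grade_space Ls)"
proof -
  have "\<forall>v\<in>set us. v = 0" if "list_all2 (\<in>) us (map grade_space Ls)" "sum_list us = 0" for us
    using that assms(1)
  proof (induction Ls arbitrary: us)
    case (Cons M Ls)
    then obtain v vs where us: "us = v # vs" "v \<in> grade_space M" "list_all2 (\<in>) vs (map grade_space Ls)"
      by (auto simp: list_all2_Cons2)
    have "sum_list vs \<in> sum_list (map grade_space Ls)"
      using us(3) by (rule sum_list_mem_sum_list)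
    then have "sum_list vs \<in> grade_space (\<Union> (set Ls))" by (simp add: sum_list_grade_space)
    moreover have "v = - sum_list vs" using Cons.prems(2) us(1) by (simp add: eq_neg_iff_add_eq_0)
    ultimately have "v \<in> grade_space (\<Union> (set Ls))" by (simp add: grade_space_def span_neg)
    moreover have "disjnt M (\<Union> (set Ls))" using Cons.prems(3) by (auto simp: disjnt_iff)
    ultimately have "v = 0" using grade_space_disjnt us(2) by blast
    then show ?case using Cons us by simp
  qed simp
  moreover have "grade_space L = sum_list (map grade_space Ls)"
    unfolding sum_list_grade_space using assms(2) by (rule grade_space_cong)
  ultimately show ?thesis unfolding is_direct_sum_def by blast
qed

lemma is_direct_sum_grades:
  assumes "distinct ls" "\<And>j b. j \<le> n \<Longrightarrow> (j, b) \<in> L \<longleftrightarrow> (j, b) \<in> set ls"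
  shows "is_direct_sum (grade_space L) (map (\<lambda>l. grade_space {l}) ls)"
proof -
  have "sorted_wrt disjnt (map (\<lambda>l. {l}) ls)"
    using assms(1) by (induction ls) auto
  from is_direct_sum_grade_space[OF this, of L] assms(2) show ?thesis
    by (simp add: o_def)
qed

section \<open>Subalgebras from closed sets of ranks and phases\<close>

text \<open>By bilinearity it suffices to multiply spanning elements, and the sign in
  \<open>u_mult\<close> is harmless in a subspace. Linearity is used first in the right factor, then
  in the left one.\<close>

lemma subalgebra_grade_space:
  assumes "\<And>A B b b'. A \<subseteq> {1..n} \<Longrightarrow> B \<subseteq> {1..n} \<Longrightarrow> (card A, b) \<in> L \<Longrightarrow> (card B, b') \<in> L \<Longrightarrow>
    (card (sym_diff A B), b \<noteq> b') \<in> L"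
  shows "subalgebra rs (grade_space L)"
  unfolding subalgebra_def
proof (intro conjI ballI)
  show "subspace (grade_space L)" by (simp add: grade_space_def)
  have base: "u x * u y \<in> grade_space L" if xy: "x \<in> graded L" "y \<in> graded L" for x y
  proof -
    obtain A b B b' where eq: "x = (A, b)" "y = (B, b')" by fastforce
    have "(sym_diff A B, b \<noteq> b') \<in> graded L"
      using xy assms[of A B b b'] phase_closed unfolding eq by (auto simp: graded_def)
    then have "u (sym_diff A B, b \<noteq> b') \<in> grade_space L"
      unfolding grade_space_def by (intro span_base imageI)
    moreover have "u x * u y \<in> {u (sym_diff A B, b \<noteq> b'), - u (sym_diff A B, b \<noteq> b')}"
      using xy unfolding eq by (intro u_mult) (auto simp: graded_def)
    ultimately show ?thesis by (auto simp: grade_space_def span_neg)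
  qed
  have right: "u x * y \<in> grade_space L" if "x \<in> graded L" "y \<in> grade_space L" for x y
    using that(2) unfolding grade_space_def
  proof (induction rule: span_induct_alt)
    case (step c v y)
    then show ?case using base[OF that(1)] unfolding grade_space_def
      by (auto simp: distrib_left rs_mult_right intro!: span_add span_scale)
  qed (simp add: span_zero)
  show "x * y \<in> grade_space L" if "x \<in> grade_space L" "y \<in> grade_space L" for x y
    using that(1) unfolding grade_space_def
  proof (induction rule: span_induct_alt)
    case (step c v x)
    then show ?case using right that(2) unfolding grade_space_def
      by (auto simp: distrib_right rs_mult_left intro!: span_add span_scale)
  qed (simp add: span_zero)
qed

lemma subalgebra_scalars: "subalgebra rs (grade_space ({0} \<times> B))" if "B \<in> {{False}, UNIV}"
  using that by (intro subalgebra_grade_space) (auto simp: finite_subset)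

text \<open>Only the empty and the full index set have size 0 or \<open>n\<close>, and these two
  sets are closed under symmetric difference. Both choices of \<open>B\<close> are closed under
  addition of phases.\<close>

lemma subalgebra_center: "subalgebra rs (grade_space ({0, n} \<times> B))" if "B \<in> {{False}, UNIV}"
proof -
  have full: "A = {} \<or> A = {1..n}" if "A \<subseteq> {1..n}" "card A \<in> {0, n}" for A
    using that card_subset_eq[of "{1..n}" A] finite_subset[OF that(1)] by auto
  show ?thesis
  proof (rule subalgebra_grade_space)
    fix A A' :: "nat set" and b b' :: bool
    assume "A \<subseteq> {1..n}" "A' \<subseteq> {1..n}"
      and L: "(card A, b) \<in> {0, n} \<times> B" "(card A', b') \<in> {0, n} \<times> B"
    then have "sym_diff A A' \<in> {{}, {1..n}}" using full[of A] full[of A'] by auto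
    then have "card (sym_diff A A') \<in> {0, n}" by auto
    moreover have "(b \<noteq> b') \<in> B" using L that by auto
    ultimately show "(card (sym_diff A A'), b \<noteq> b') \<in> {0, n} \<times> B" by blast
  qed
qed

lemma subalgebra_even: "subalgebra rs (grade_space (Collect even \<times> B))" if "B \<in> {{False}, UNIV}"
  using that by (intro subalgebra_grade_space)
    (auto simp: even_card_sym_diff finite_subset[of _ "{1..n}"])

text \<open>Rank parity and phase both add modulo 2 under multiplication, so the condition that they
  agree is preserved.\<close>

lemma subalgebra_phase_parity: "subalgebra rs (grade_space {(j, b). b = odd j})"
  by (intro subalgebra_grade_space) (auto simp: even_card_sym_diff finite_subset[of _ "{1..n}"])

lemma subalgebra_all: "subalgebra rs (grade_space (UNIV \<times> {False}))"
  by (intro subalgebra_grade_space) auto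

lemma subalgebra_hat_0: "subalgebra rs (rank_space rs g n 0)"
  using subalgebra_scalars[of "{False}"] by (simp add: rank_space_eq)

text \<open>The condition \<open>n \<ge> 1\<close> keeps the ranks 0 and \<open>n\<close> distinct,
  without which the sum would not be direct.\<close>

lemma direct_sum_hat_0_n:
  assumes "n \<ge> 1"
  shows "\<exists>W. is_direct_sum W [rank_space rs g n 0, rank_space rs g n n] \<and> subalgebra rs W"
proof (intro exI conjI)
  show "is_direct_sum (grade_space ({0, n} \<times> {False})) [rank_space rs g n 0, rank_space rs g n n]"
    using is_direct_sum_grades[of "[(0, False), (n, False)]" "{0, n} \<times> {False}"] assms
    unfolding rank_space_eq by auto
qed (rule subalgebra_center, simp)

lemma bar_space_even: "bar_space rs g n [0, 2] = grade_space (Collect even \<times> {False})"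
  unfolding bar_space_eq by (rule grade_space_cong) (simp add: mod_4_parity)

lemma direct_sum_even:
  assumes "n \<ge> 1" "even k" "k \<in> {n, n - 1}"
  shows "is_direct_sum (bar_space rs g n [0, 2]) (map (rank_space rs g n) (filter even [0..<Suc k]))"
proof -
  have "is_direct_sum (grade_space (Collect even \<times> {False}))
      (map (\<lambda>l. grade_space {l}) (map (\<lambda>j. (j, False)) (filter even [0..<Suc k])))"
    using even_le_even_bound[OF assms]
    by (intro is_direct_sum_grades) (auto simp: distinct_map inj_on_def simp del: upt_Suc)
  then show ?thesis
    unfolding bar_space_even rank_space_eq by (simp add: o_def del: upt_Suc)
qed

lemma subalgebra_bar_even: "subalgebra rs (bar_space rs g n [0, 2])"
  by (simp add: bar_space_even subalgebra_even)

end

section \<open>The real and the complex algebra as instances\<close>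

lemma phased_blades_real:
  assumes "clifford_algebra s g p q"
  shows "phased_blades s g (p + q) {False} (\<lambda>x. blade g (fst x))"
proof -
  interpret clifford_algebra s g p q by fact
  show ?thesis
  proof unfold_locales
    fix c :: "nat set \<times> bool \<Rightarrow> real" and x :: "nat set \<times> bool"
    assume sum: "(\<Sum>x\<in>Pow {1..p + q} \<times> {False}. s (c x) (blade g (fst x))) = 0"
      and x: "x \<in> Pow {1..p + q} \<times> {False}"
    have "(\<Sum>A\<in>Pow {1..p + q}. s (c (A, False)) (blade g A))
        = (\<Sum>x\<in>Pow {1..p + q} \<times> {False}. s (c x) (blade g (fst x)))"
      by (rule sum.reindex_bij_witness[of _ fst "\<lambda>A. (A, False)"]) auto
    then show "c x = 0" using blade_sum_zero[of "\<lambda>A. c (A, False)" "fst x"] sum x by auto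
  qed (use blade_mult in \<open>auto simp: scale_mult_left scale_mult_right\<close>)
qed

locale complex_clifford_algebra = clifford_algebra scale g p q
  for scale :: "complex \<Rightarrow> 'a::ring_1 \<Rightarrow> 'a" and g p q
begin

text \<open>Real independence of the blades and their multiples by the imaginary unit comes from
  complex independence of the blades: the two real coefficients at \<open>A\<close> are the real and
  imaginary parts of one complex coefficient.\<close>

sublocale real: phased_blades "restrict_real scale" g "p + q" UNIV
  "\<lambda>x. scale (if snd x then \<i> else 1) (blade g (fst x))"
proof unfold_locales
  fix A B :: "nat set" and b b' :: bool
  assume "A \<subseteq> {1..p + q}" "B \<subseteq> {1..p + q}"
  from blade_mult[OF _ this]
  \<comment> \<open>If both phases are \<open>True\<close>, the imaginary unit squares to -1, which
    merely flips the sign left open in the claim.\<close>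
  show "scale (if snd (A, b) then \<i> else 1) (blade g (fst (A, b)))
      * scale (if snd (B, b') then \<i> else 1) (blade g (fst (B, b')))
    \<in> {scale (if snd (sym_diff A B, b \<noteq> b') then \<i> else 1) (blade g (fst (sym_diff A B, b \<noteq> b'))),
       - scale (if snd (sym_diff A B, b \<noteq> b') then \<i> else 1) (blade g (fst (sym_diff A B, b \<noteq> b')))}"
    by (auto simp: scale_mult_left scale_mult_right)
next
  fix c :: "nat set \<times> bool \<Rightarrow> real" and x :: "nat set \<times> bool"
  let ?P = "Pow {1..p + q}"
  assume sum: "(\<Sum>x\<in>?P \<times> UNIV. restrict_real scale (c x)
      (scale (if snd x then \<i> else 1) (blade g (fst x)))) = 0" and x: "x \<in> ?P \<times> UNIV"
  have "(\<Sum>A\<in>?P. scale (Complex (c (A, False)) (c (A, True))) (blade g A))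
      = (\<Sum>A\<in>?P. \<Sum>b\<in>UNIV. scale (of_real (c (A, b)) * (if b then \<i> else 1)) (blade g A))"
    by (intro sum.cong refl)
      (simp add: UNIV_bool Complex_eq scale_left_distrib[symmetric] mult.commute add.commute)
  also have "\<dots> = 0"
    using sum by (simp add: sum.cartesian_product restrict_real_def case_prod_unfold)
  finally have "Complex (c (A, False)) (c (A, True)) = 0" if "A \<in> ?P" for A
    using that blade_sum_zero[of "\<lambda>A. Complex (c (A, False)) (c (A, True))"] by auto
  then have "c (fst x, False) = 0" "c (fst x, True) = 0"
    using x by (force simp: complex_eq_iff)+
  then show "c x = 0" by (cases x; cases "snd x") auto
qed (auto simp: restrict_real_def scale_mult_left scale_mult_right scale_right_distrib
    scale_left_distrib mult.commute)

text \<open>Multiplication by the imaginary unit is linear over the reals, so it maps spans to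
  spans, and it turns each generator of phase \<open>False\<close> into the one of phase
  \<open>True\<close> with the same index set.\<close>

lemma scale_i_grade_space:
  "scale \<i> ` real.grade_space (K \<times> {False}) = real.grade_space (K \<times> {True})"
proof -
  let ?u = "\<lambda>x. scale (if snd x then \<i> else 1) (blade g (fst x))"
  interpret i: Vector_Spaces.linear "restrict_real scale" "restrict_real scale" "scale \<i>"
    by unfold_locales (simp_all add: restrict_real_def scale_right_distrib mult.commute)
  have "real.graded (K \<times> {True}) = (\<lambda>x. (fst x, True)) ` real.graded (K \<times> {False})"
    by (force simp: real.graded_def)
  moreover have "scale \<i> (?u x) = ?u (fst x, True)" if "x \<in> real.graded (K \<times> {False})" for x
    using that by (simp add: real.graded_def mem_Times_iff)
  ultimately have "scale \<i> ` ?u ` real.graded (K \<times> {False}) = ?u ` real.graded (K \<times> {True})"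
    by (simp only: image_image cong: image_cong)
  then show ?thesis by (simp add: real.grade_space_def flip: i.span_image)
qed

lemma scale_minus_grade_space: "scale (- c) ` real.grade_space L = scale c ` real.grade_space L"
proof -
  have "uminus ` real.grade_space L = real.grade_space L"
    using real.span_neg by (force simp: real.grade_space_def image_iff)
  moreover have "scale (- c) ` X = scale c ` uminus ` X" for X
    by (simp add: image_image)
  ultimately show ?thesis by simp
qed

text \<open>Up to sign, the power of the imaginary unit is 1 for even \<open>j\<close> and the unit
  itself for odd \<open>j\<close>. Signs do not change a subspace, so \<open>m\<close> can stay
  arbitrary.\<close>

lemma scale_phase_grade_space:
  "scale (\<i> ^ j * (- 1) ^ m) ` real.grade_space {(j, False)} = real.grade_space {(j, odd j)}"
proof -
  have c: "if odd j then \<i> ^ j * (- 1) ^ m = \<i> \<or> \<i> ^ j * (- 1) ^ m = - \<i>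
    else \<i> ^ j * (- 1) ^ m = 1 \<or> \<i> ^ j * (- 1) ^ m = - 1"
  proof (cases "even j")
    case True
    then obtain l where "j = 2 * l" by blast
    then show ?thesis by (cases "even m"; cases "even l") (simp_all add: power_mult)
  next
    case False
    then obtain l where "j = 2 * l + 1" by (blast elim: oddE)
    then show ?thesis by (cases "even m"; cases "even l") (simp_all add: power_mult)
  qed
  have i: "scale \<i> ` real.grade_space {(j, False)} = real.grade_space {(j, True)}"
    using scale_i_grade_space[of "{j}"] by simp
  have one: "scale 1 ` real.grade_space {(j, False)} = real.grade_space {(j, False)}"
    by simp
  show ?thesis
  proof (cases "odd j")
    case True
    with c have "\<i> ^ j * (- 1) ^ m = \<i> \<or> \<i> ^ j * (- 1) ^ m = - \<i>" by simp
    then show ?thesis using True by (elim disjE) (simp_all add: scale_minus_grade_space i del: scale_minus_left)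
  next
    case False
    with c have "\<i> ^ j * (- 1) ^ m = 1 \<or> \<i> ^ j * (- 1) ^ m = - 1" by simp
    then show ?thesis using False by (elim disjE) (simp_all only: scale_minus_grade_space one)
  qed
qed

end

section \<open>The listed subspaces of the real and complex algebras\<close>

lemma distinct_concat_phases:
  "distinct js \<Longrightarrow> distinct (concat (map (\<lambda>j. [(j, False), (j, True)]) js))"
  by (induction js) auto

theorem theorem8:
  fixes p q n k :: nat
    and sR :: "real \<Rightarrow> 'a::ring_1 \<Rightarrow> 'a" and gR :: "nat \<Rightarrow> 'a"
    and sC :: "complex \<Rightarrow> 'b::ring_1 \<Rightarrow> 'b" and gC :: "nat \<Rightarrow> 'b"
  assumes "n = p + q" and "n \<ge> 1"
    and "even k" and "k \<in> {n, n - 1}"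
  shows
    "(clifford_algebra sR gR p q \<longrightarrow>
       (let hat = rank_space sR gR n;
            bar = bar_space sR gR n;
            evens = filter even [0..<Suc k]
        in subalgebra sR (hat 0)
         \<and> (\<exists>W. is_direct_sum W [hat 0, hat n] \<and> subalgebra sR W)
         \<and> is_direct_sum (bar [0, 2]) (map hat evens) \<and> subalgebra sR (bar [0, 2])))
     \<and>
     (clifford_algebra sC gC p q \<longrightarrow>
       (let rs = restrict_real sC;
            hat = rank_space rs gC n;
            bar = bar_space rs gC n;
            mul = (\<lambda>c V. sC c ` V);
            evens = filter even [0..<Suc k]
        in subalgebra rs (hat 0)
         \<and> (\<exists>W. is_direct_sum W [hat 0, hat n] \<and> subalgebra rs W)
         \<and> is_direct_sum (bar [0, 2]) (map hat evens) \<and> subalgebra rs (bar [0, 2])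
         \<and> (\<exists>W. is_direct_sum W [hat 0, mul \<i> (hat 0)] \<and> subalgebra rs W)
         \<and> (\<exists>W. is_direct_sum W [hat 0, hat n, mul \<i> (hat 0), mul \<i> (hat n)] \<and> subalgebra rs W)
         \<and> (\<exists>W. is_direct_sum W (concat (map (\<lambda>j. [hat j, mul \<i> (hat j)]) evens))
              \<and> is_direct_sum W [bar [0, 2], mul \<i> (bar [0, 2])]
              \<and> subalgebra rs W)
         \<and> (\<exists>W. is_direct_sum W
                (map (\<lambda>j. mul (\<i> ^ j * (- 1) ^ (j * (j - 1) div 2)) (hat j)) [0..<Suc n])
              \<and> is_direct_sum W [bar [0, 2], mul \<i> (bar [1, 3])]
              \<and> subalgebra rs W)
         \<and> is_direct_sum (bar [0, 1, 2, 3]) (map hat [0..<Suc n])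
         \<and> subalgebra rs (bar [0, 1, 2, 3])))"
proof (intro conjI impI)
  assume "clifford_algebra sR gR p q"
  then interpret phased_blades sR gR n "{False}" "\<lambda>x. blade gR (fst x)"
    using phased_blades_real assms(1) by blast
  show "let hat = rank_space sR gR n;
            bar = bar_space sR gR n;
            evens = filter even [0..<Suc k]
        in subalgebra sR (hat 0)
         \<and> (\<exists>W. is_direct_sum W [hat 0, hat n] \<and> subalgebra sR W)
         \<and> is_direct_sum (bar [0, 2]) (map hat evens) \<and> subalgebra sR (bar [0, 2])"
    unfolding Let_def using subalgebra_hat_0 direct_sum_hat_0_n direct_sum_even subalgebra_bar_even assms(2-4)
    by blast
next
  assume "clifford_algebra sC gC p q"
  then interpret complex_clifford_algebra sC gC p q
    by (simp add: complex_clifford_algebra_def)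
  note n = assms(1)[symmetric]
  let ?rs = "restrict_real sC" and ?V = real.grade_space and ?evens = "filter even [0..<Suc k]"
  let ?hat = "rank_space ?rs gC n" and ?bar = "bar_space ?rs gC n" and ?mul = "\<lambda>c V. sC c ` V"
  have hat: "?hat j = ?V {(j, False)}" for j
    using real.rank_space_eq by (simp add: n)
  have bar: "?bar ks = ?V ({j. j mod 4 \<in> set ks} \<times> {False})" for ks
    using real.bar_space_eq by (simp add: n)
  have i_hat: "?mul \<i> (?V {(j, False)}) = ?V {(j, True)}" for j
    using scale_i_grade_space[of "{j}"] by simp
  have even_le: "j < Suc k \<longleftrightarrow> j \<le> n" if "even j" for j
    using even_le_even_bound[OF assms(2-4) that] by auto

  have scalars: "\<exists>W. is_direct_sum W [?hat 0, ?mul \<i> (?hat 0)] \<and> subalgebra ?rs W"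
  proof (intro exI conjI)
    show "is_direct_sum (?V ({0} \<times> UNIV)) [?hat 0, ?mul \<i> (?hat 0)]"
      using real.is_direct_sum_grades[of "[(0, False), (0, True)]" "{0} \<times> UNIV"]
      unfolding hat i_hat by auto
  qed (rule real.subalgebra_scalars, simp)

  have center: "\<exists>W. is_direct_sum W [?hat 0, ?hat n, ?mul \<i> (?hat 0), ?mul \<i> (?hat n)] \<and> subalgebra ?rs W"
  proof (intro exI conjI)
    show "is_direct_sum (?V ({0, n} \<times> UNIV)) [?hat 0, ?hat n, ?mul \<i> (?hat 0), ?mul \<i> (?hat n)]"
      using real.is_direct_sum_grades[of "[(0, False), (n, False), (0, True), (n, True)]" "{0, n} \<times> UNIV"]
        assms(2) unfolding hat i_hat by auto
    show "subalgebra ?rs (?V ({0, n} \<times> UNIV))"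
      using real.subalgebra_center by (simp add: n)
  qed

  have even: "\<exists>W. is_direct_sum W (concat (map (\<lambda>j. [?hat j, ?mul \<i> (?hat j)]) ?evens))
      \<and> is_direct_sum W [?bar [0, 2], ?mul \<i> (?bar [0, 2])] \<and> subalgebra ?rs W"
  proof (intro exI conjI)
    \<comment> \<open>The same space is decomposed twice: by rank and phase into single pieces, then
      by phase alone into two pieces.\<close>
    let ?L = "Collect even \<times> (UNIV :: bool set)"
    let ?ls = "concat (map (\<lambda>j. [(j, False), (j, True)]) ?evens)"
    have "is_direct_sum (?V ?L) (map (\<lambda>l. ?V {l}) ?ls)"
      using even_le by (intro real.is_direct_sum_grades distinct_concat_phases) (auto simp: n simp del: upt_Suc)
    then show "is_direct_sum (?V ?L) (concat (map (\<lambda>j. [?hat j, ?mul \<i> (?hat j)]) ?evens))"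
      unfolding hat i_hat by (simp add: map_concat o_def del: upt_Suc)
    have "is_direct_sum (?V ?L) (map ?V (map (\<lambda>b. {j. j mod 4 \<in> {0, 2}} \<times> {b}) [False, True]))"
      by (rule real.is_direct_sum_grade_space) (auto simp: disjnt_iff mod_4_parity)
    then show "is_direct_sum (?V ?L) [?bar [0, 2], ?mul \<i> (?bar [0, 2])]"
      unfolding bar scale_i_grade_space by simp
  qed (rule real.subalgebra_even, simp)

  have phase: "\<exists>W. is_direct_sum W
        (map (\<lambda>j. ?mul (\<i> ^ j * (- 1) ^ (j * (j - 1) div 2)) (?hat j)) [0..<Suc n])
      \<and> is_direct_sum W [?bar [0, 2], ?mul \<i> (?bar [1, 3])] \<and> subalgebra ?rs W"
  proof (intro exI conjI)
    \<comment> \<open>Each rank occurs with exactly one phase, the one given by its parity; this is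
      where the scalar factors put the rank spaces.\<close>
    let ?L = "{(j, b). b = odd (j::nat)}"
    have "is_direct_sum (?V ?L) (map (\<lambda>l. ?V {l}) (map (\<lambda>j. (j, odd j)) [0..<Suc n]))"
      by (intro real.is_direct_sum_grades) (auto simp: n distinct_map inj_on_def simp del: upt_Suc)
    then show "is_direct_sum (?V ?L)
        (map (\<lambda>j. ?mul (\<i> ^ j * (- 1) ^ (j * (j - 1) div 2)) (?hat j)) [0..<Suc n])"
      unfolding hat scale_phase_grade_space by (simp add: o_def del: upt_Suc)
    \<comment> \<open>Residues 0 and 2 modulo 4 collect the even ranks, 1 and 3 the odd ones, so
      this groups the pieces by phase.\<close>
    have "is_direct_sum (?V ?L)
        (map ?V [{j. j mod 4 \<in> {0, 2}} \<times> {False}, {j. j mod 4 \<in> {1, 3}} \<times> {True}])"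
      by (rule real.is_direct_sum_grade_space) (auto simp: disjnt_iff mod_4_parity)
    then show "is_direct_sum (?V ?L) [?bar [0, 2], ?mul \<i> (?bar [1, 3])]"
      unfolding bar scale_i_grade_space by simp
  qed (rule real.subalgebra_phase_parity)

  have "{j. j mod 4 \<in> set [0, 1, 2, 3]} = (UNIV :: nat set)"
    by auto
  then have bar_all: "?bar [0, 1, 2, 3] = ?V (UNIV \<times> {False})" by (simp add: bar)
  have "is_direct_sum (?V (UNIV \<times> {False})) (map (\<lambda>l. ?V {l}) (map (\<lambda>j. (j, False)) [0..<Suc n]))"
    by (intro real.is_direct_sum_grades) (auto simp: n distinct_map inj_on_def simp del: upt_Suc)
  then have all: "is_direct_sum (?bar [0, 1, 2, 3]) (map ?hat [0..<Suc n])"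
    unfolding bar_all hat by (simp add: o_def del: upt_Suc)

  show "let rs = restrict_real sC;
            hat = rank_space rs gC n;
            bar = bar_space rs gC n;
            mul = (\<lambda>c V. sC c ` V);
            evens = filter even [0..<Suc k]
        in subalgebra rs (hat 0)
         \<and> (\<exists>W. is_direct_sum W [hat 0, hat n] \<and> subalgebra rs W)
         \<and> is_direct_sum (bar [0, 2]) (map hat evens) \<and> subalgebra rs (bar [0, 2])
         \<and> (\<exists>W. is_direct_sum W [hat 0, mul \<i> (hat 0)] \<and> subalgebra rs W)
         \<and> (\<exists>W. is_direct_sum W [hat 0, hat n, mul \<i> (hat 0), mul \<i> (hat n)] \<and> subalgebra rs W)
         \<and> (\<exists>W. is_direct_sum W (concat (map (\<lambda>j. [hat j, mul \<i> (hat j)]) evens))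
              \<and> is_direct_sum W [bar [0, 2], mul \<i> (bar [0, 2])]
              \<and> subalgebra rs W)
         \<and> (\<exists>W. is_direct_sum W
                (map (\<lambda>j. mul (\<i> ^ j * (- 1) ^ (j * (j - 1) div 2)) (hat j)) [0..<Suc n])
              \<and> is_direct_sum W [bar [0, 2], mul \<i> (bar [1, 3])]
              \<and> subalgebra rs W)
         \<and> is_direct_sum (bar [0, 1, 2, 3]) (map hat [0..<Suc n])
         \<and> subalgebra rs (bar [0, 1, 2, 3])"
    unfolding Let_def
    using real.subalgebra_hat_0 real.direct_sum_hat_0_n[unfolded n, OF assms(2)]
      real.direct_sum_even[unfolded n, OF assms(2-4)] real.subalgebra_bar_even
      scalars center even phase all real.subalgebra_all[folded bar_all]
    by (simp only: n)
qed

end
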